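(* (Christoffel–Darboux formula.) Let $\mathcal L$ be a positive definite linear functional on $\prod^{N,M}$ with vector orthonormal polynomials $\{\Phi_{n,m}\}$, $\{\tilde\Phi_{n,m}\}$ as in the context. For $0\le n\le N$, $0\le m\le M$ and $z,w,z_1,w_1\in\mathbb{C}$ with $\bar z_1z\ne1$, $$\frac{\overleftarrow\Phi_{n,m}(z,w)\,\overleftarrow\Phi_{n,m}(z_1,w_1)^\dagger-\bar z_1z\,\Phi_{n,m}(z,w)^T\,\overline{\Phi_{n,m}(z_1,w_1)}}{1-\bar z_1z}=\sum_{k=0}^n\Phi_{k,m}(z,w)^T\,\overline{\Phi_{k,m}(z_1,w_1)}=\sum_{j=0}^m\tilde\Phi_{n,j}(z,w)^T\,\overline{\tilde\Phi_{n,j}(z_1,w_1)}.$$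
   Context: $\prod^{N,M}=\mathrm{span}\{z^iw^j:|i|\le N,|j|\le M\}$, $\hat\prod^{N,M}=\mathrm{span}\{z^iw^j:0\le i\le N,0\le j\le M\}$. A linear functional $\mathcal L$ on $\prod^{N,M}$ with $\mathcal L(z^{-i}w^{-j})=\overline{\mathcal L(z^iw^j)}$ is positive definite if $\langle p,p\rangle>0$ for all nonzero $p\in\hat\prod^{N,M}$, where $\langle p,q\rangle=\mathcal L\big(p(z,w)\,\overline{q(1/\bar z,1/\bar w)}\big)$. For $0\le l\le m$, $\phi^l_{n,m}$ is the unique element of $\mathrm{span}(\{z^iw^j:0\le i<n,0\le j\le m\}\cup\{z^nw^j:0\le j\le l\})$ with positive coefficient of $z^nw^l$, $\langle\phi^l_{n,m},\phi^l_{n,m}\rangle=1$, orthogonal to all of these monomials except $z^nw^l$; $\Phi_{n,m}=[\phi^m_{n,m},\dots,\phi^0_{n,m}]^T$. For $0\le l\le n$, $\tilde\phi^l_{n,m}$ is the unique element of $\mathrm{span}(\{z^iw^j:0\le i\le n,0\le j<m\}\cup\{z^iw^m:0\le i\le l\})$ with positive coefficient of $z^lw^m$, norm one, orthogonal to all of these monomials except $z^lw^m$; $\tilde\Phi_{n,m}=[\tilde\phi^n_{n,m},\dots,\tilde\phi^0_{n,m}]^T$. The reversal is the row vector $\overleftarrow\Phi_{n,m}(z,w)=z^nw^m\Phi_{n,m}(1/\bar z,1/\bar w)^\dagger$. In the formula $\overleftarrow\Phi_{n,m}(z_1,w_1)^\dagger$ and $\overline{\Phi_{n,m}(z_1,w_1)}$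 are the conjugate transpose, respectively entrywise conjugate, of the value at the point $(z_1,w_1)$. *)

theory Defs
  imports
    "HOL-Library.Poly_Mapping"
    "HOL-Library.Product_Plus"
    "HOL-Library.Complex_Order"
    "Jordan_Normal_Form.Matrix"
begin

text \<open>Laurent polynomials in \<open>z, w\<close> are the group ring of \<open>\<int> \<times> \<int>\<close>: the key
  \<open>(i, j)\<close> carries the coefficient of \<open>z\<^sup>i w\<^sup>j\<close>, and multiplication is the ring
  multiplication of \<open>HOL-Library.Poly_Mapping\<close>.\<close>

type_synonym laurent = "(int \<times> int) \<Rightarrow>\<^sub>0 complex"

abbreviation lcoeff :: "laurent \<Rightarrow> int \<times> int \<Rightarrow> complex" where
  "lcoeff \<equiv> Poly_Mapping.lookup"

definition lmono :: "int \<times> int \<Rightarrow> laurent" where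
  "lmono a = Poly_Mapping.single a 1"

lift_definition lscale :: "complex \<Rightarrow> laurent \<Rightarrow> laurent" is "\<lambda>c p a. c * p a"
  by (erule rev_finite_subset) auto

lemma vector_space_lscale: "vector_space lscale"
  by unfold_locales (transfer, simp add: algebra_simps fun_eq_iff)+

interpretation laurent: vector_space lscale
  by (fact vector_space_lscale)

text \<open>Terms with a negative exponent of a vanishing variable evaluate to 0 by the convention
  of \<open>powi\<close>; for polynomials this is the usual evaluation on all of \<open>\<complex>\<^sup>2\<close>.\<close>

definition leval :: "laurent \<Rightarrow> complex \<Rightarrow> complex \<Rightarrow> complex" where
  "leval p z w = (\<Sum>(i, j)\<in>Poly_Mapping.keys p. lcoeff p (i, j) * z powi i * w powi j)"

text \<open>The Laurent polynomial \<open>cnj (p (1 / cnj z) (1 / cnj w))\<close>, which has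
  coefficient \<open>cnj (lcoeff p (-i, -j))\<close> at \<open>z\<^sup>i w\<^sup>j\<close>.\<close>

lift_definition lstar :: "laurent \<Rightarrow> laurent" is "\<lambda>p (i, j). cnj (p (- i, - j))"
proof -
  fix p :: "int \<times> int \<Rightarrow> complex"
  assume "finite {a. p a \<noteq> 0}"
  then have "finite ((\<lambda>(i, j). (- i, - j)) ` {a. p a \<noteq> 0})" by simp
  then show "finite {a. (case a of (i, j) \<Rightarrow> cnj (p (- i, - j))) \<noteq> 0}"
    by (rule rev_finite_subset) (force simp: image_iff)
qed

definition lspan :: "(int \<times> int) set \<Rightarrow> laurent set" where
  "lspan S = laurent.span (lmono ` S)"

definition Pi_sp :: "nat \<Rightarrow> nat \<Rightarrow> laurent set" where
  "Pi_sp N M = lspan {(i, j). \<bar>i\<bar> \<le> int N \<and> \<bar>j\<bar> \<le> int M}"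

definition Pi_hat :: "nat \<Rightarrow> nat \<Rightarrow> laurent set" where
  "Pi_hat N M = lspan {(i, j). 0 \<le> i \<and> i \<le> int N \<and> 0 \<le> j \<and> j \<le> int M}"

definition bracket :: "(laurent \<Rightarrow> complex) \<Rightarrow> laurent \<Rightarrow> laurent \<Rightarrow> complex" where
  "bracket L p q = L (p * lstar q)"

text \<open>The values of \<open>L\<close> outside \<open>Pi_sp N M\<close> are unconstrained. On \<open>complex\<close>, \<open>0 < c\<close> means
  that \<open>c\<close> is real and positive.\<close>

definition hermitian_functional :: "nat \<Rightarrow> nat \<Rightarrow> (laurent \<Rightarrow> complex) \<Rightarrow> bool" where
  "hermitian_functional N M L \<longleftrightarrow>
     (\<forall>p\<in>Pi_sp N M. \<forall>q\<in>Pi_sp N M. L (p + q) = L p + L q) \<and>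
     (\<forall>c. \<forall>p\<in>Pi_sp N M. L (lscale c p) = c * L p) \<and>
     (\<forall>i j. \<bar>i\<bar> \<le> int N \<longrightarrow> \<bar>j\<bar> \<le> int M \<longrightarrow> L (lmono (- i, - j)) = cnj (L (lmono (i, j))))"

definition positive_definite_functional :: "nat \<Rightarrow> nat \<Rightarrow> (laurent \<Rightarrow> complex) \<Rightarrow> bool" where
  "positive_definite_functional N M L \<longleftrightarrow>
     hermitian_functional N M L \<and> (\<forall>p\<in>Pi_hat N M. p \<noteq> 0 \<longrightarrow> 0 < bracket L p p)"

definition orthonormal_elt ::
    "(laurent \<Rightarrow> complex) \<Rightarrow> (int \<times> int) set \<Rightarrow> int \<times> int \<Rightarrow> laurent" where
  "orthonormal_elt L S a =
     (THE p. p \<in> lspan S \<and> 0 < lcoeff p a \<and> bracket L p p = 1 \<and>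
             (\<forall>b\<in>S - {a}. bracket L p (lmono b) = 0))"

definition phi :: "(laurent \<Rightarrow> complex) \<Rightarrow> nat \<Rightarrow> nat \<Rightarrow> nat \<Rightarrow> laurent" where
  "phi L n m l = orthonormal_elt L
     ({(i, j). 0 \<le> i \<and> i < int n \<and> 0 \<le> j \<and> j \<le> int m} \<union>
      {(i, j). i = int n \<and> 0 \<le> j \<and> j \<le> int l})
     (int n, int l)"

definition phi_tilde :: "(laurent \<Rightarrow> complex) \<Rightarrow> nat \<Rightarrow> nat \<Rightarrow> nat \<Rightarrow> laurent" where
  "phi_tilde L n m l = orthonormal_elt L
     ({(i, j). 0 \<le> i \<and> i \<le> int n \<and> 0 \<le> j \<and> j < int m} \<union>
      {(i, j). 0 \<le> i \<and> i \<le> int l \<and> j = int m})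
     (int l, int m)"

text \<open>Type \<open>vec\<close> does not distinguish rows from columns, so a row times a column is the scalar
  product, and \<open>u \<bullet>c v\<close> is \<open>u\<close> (as a row) times the entrywise conjugate of \<open>v\<close> (as a column).\<close>

definition Phi :: "(laurent \<Rightarrow> complex) \<Rightarrow> nat \<Rightarrow> nat \<Rightarrow> laurent vec" where
  "Phi L n m = vec (m + 1) (\<lambda>k. phi L n m (m - k))"

definition Phi_tilde :: "(laurent \<Rightarrow> complex) \<Rightarrow> nat \<Rightarrow> nat \<Rightarrow> laurent vec" where
  "Phi_tilde L n m = vec (n + 1) (\<lambda>k. phi_tilde L n m (n - k))"

definition Phi_rev :: "(laurent \<Rightarrow> complex) \<Rightarrow> nat \<Rightarrow> nat \<Rightarrow> laurent vec" where
  "Phi_rev L n m = map_vec (\<lambda>p. lmono (int n, int m) * lstar p) (Phi L n m)"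

definition veval :: "laurent vec \<Rightarrow> complex \<Rightarrow> complex \<Rightarrow> complex vec" where
  "veval v z w = map_vec (\<lambda>p. leval p z w) v"

end

theory Submission
  imports Defs
begin

text \<open>For an orthonormal basis \<open>e\<close> of the polynomials with exponents in a set \<open>S\<close>, the kernel
  \<open>\<Sum>i. e i (x) * cnj (e i (y))\<close> depends on \<open>S\<close> only. All \<open>\<phi>\<^sup>l\<^bsub>k,m\<^esub>\<close> with \<open>k \<le> n\<close>, and likewise
  all \<open>\<phi>\<close>-tilde of level \<open>(n, j)\<close> with \<open>j \<le> m\<close>, form such a basis for the rectangle with
  corner \<open>(n, m)\<close>; this is the second equality. A third basis consists of the reversals of the
  \<open>\<phi>\<^sup>l\<^bsub>n,m\<^esub>\<close>, which are orthogonal to \<open>z\<^sup>i w\<^sup>j\<close> for \<open>i > 0\<close>, together with the products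
  \<open>z \<phi>\<^sup>l\<^bsub>k,m\<^esub>\<close> for \<open>k < n\<close>. With \<open>K\<^sub>n\<close> the kernel of the rectangle, it shows that
  \<open>K\<^sub>n - z cnj z\<^sub>1 K\<^bsub>n-1\<^esub>\<close> is the product of the reversed vectors, and
  \<open>K\<^bsub>n-1\<^esub> = K\<^sub>n - \<Phi>\<^sup>T cnj \<Phi>\<close> gives the first equality.\<close>

section \<open>Monomials, scaling and spans of exponent sets\<close>

lemma lcoeff_lmono: "lcoeff (lmono a) b = (if a = b then 1 else 0)"
  by (simp add: lmono_def lookup_single when_def)

lemma lcoeff_lscale [simp]: "lcoeff (lscale c p) a = c * lcoeff p a"
  by transfer simp

text \<open>Scalars become constant Laurent polynomials, so moving them through products is a matter
  of ring laws.\<close>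

lemma lscale_conv_mult: "lscale c p = Poly_Mapping.single 0 c * p"
proof -
  have "lscale c p = Poly_Mapping.map ((*) c) p"
    by (rule poly_mapping_eqI) (simp add: Poly_Mapping.map.rep_eq when_def)
  then show ?thesis
    by (simp add: mult_map_scale_conv_mult)
qed

lemma mult_lscale_left: "lscale c p * q = lscale c (p * q)"
  by (simp add: lscale_conv_mult mult.assoc)

lemma mult_lscale_right: "p * lscale c q = lscale c (p * q)"
  by (simp add: lscale_conv_mult mult.left_commute)

lemma laurent_expansion: "p = (\<Sum>a\<in>Poly_Mapping.keys p. lscale (lcoeff p a) (lmono a))"
proof (rule poly_mapping_eqI)
  fix b
  show "lcoeff p b = lcoeff (\<Sum>a\<in>Poly_Mapping.keys p. lscale (lcoeff p a) (lmono a)) b"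
    by (simp add: lookup_sum lcoeff_lmono in_keys_iff if_distrib[of "(*) _"] cong: if_cong)
qed

text \<open>Membership in a span of monomials depends on the support alone, so inclusions of spans
  reduce to inclusions of exponent sets.\<close>

lemma lspan_iff: "p \<in> lspan S \<longleftrightarrow> Poly_Mapping.keys p \<subseteq> S"
proof
  assume "p \<in> lspan S"
  then have "p \<in> laurent.span (lmono ` S)" by (simp add: lspan_def)
  then show "Poly_Mapping.keys p \<subseteq> S"
  proof (induction rule: laurent.span_induct_alt)
    case base
    then show ?case by simp
  next
    case (step c x y)
    then show ?case
      by (auto simp: in_keys_iff lookup_add lcoeff_lmono split: if_splits)
  qed
next
  assume "Poly_Mapping.keys p \<subseteq> S"
  then have "(\<Sum>a\<in>Poly_Mapping.keys p. lscale (lcoeff p a) (lmono a)) \<in> lspan S"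
    unfolding lspan_def
    by (intro laurent.span_sum laurent.span_scale laurent.span_base) auto
  then show "p \<in> lspan S"
    using laurent_expansion[of p] by simp
qed

lemma lspan_mono: "p \<in> lspan S \<Longrightarrow> S \<subseteq> T \<Longrightarrow> p \<in> lspan T"
  by (auto simp: lspan_iff)

lemma lspan_add: "p \<in> lspan S \<Longrightarrow> q \<in> lspan S \<Longrightarrow> p + q \<in> lspan S"
  by (simp add: lspan_def laurent.span_add)

lemma lspan_diff: "p \<in> lspan S \<Longrightarrow> q \<in> lspan S \<Longrightarrow> p - q \<in> lspan S"
  by (simp add: lspan_def laurent.span_diff)

lemma lspan_scale: "p \<in> lspan S \<Longrightarrow> lscale c p \<in> lspan S"
  by (simp add: lspan_def laurent.span_scale)

lemma lspan_sum: "(\<And>i. i \<in> I \<Longrightarrow> f i \<in> lspan S) \<Longrightarrow> sum f I \<in> lspan S"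
  by (simp add: lspan_def laurent.span_sum)

lemma lspan_lmono: "a \<in> S \<Longrightarrow> lmono a \<in> lspan S"
  by (simp add: lspan_def laurent.span_base)

lemma lspan_mult:
  assumes "p \<in> lspan S" and "q \<in> lspan T" and "\<And>a b. a \<in> S \<Longrightarrow> b \<in> T \<Longrightarrow> a + b \<in> U"
  shows "p * q \<in> lspan U"
  using assms(1,2) unfolding lspan_iff
  by (intro order.trans[OF keys_mult]) (use assms(3) in blast)

text \<open>Reduces linear and conjugate linear statements to monomials. Keeping
  \<open>q \<in> lspan S\<close> in the step makes laws available that hold only on a subspace, such
  as additivity of \<open>L\<close> on \<open>Pi_sp N M\<close>.\<close>

lemma lspan_induct [consumes 1, case_names zero add]:
  assumes "p \<in> lspan S" and "P 0"
    and "\<And>c a q. a \<in> S \<Longrightarrow> q \<in> lspan S \<Longrightarrow> P q \<Longrightarrow> P (lscale c (lmono a) + q)"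
  shows "P p"
proof -
  have "p \<in> laurent.span (lmono ` S)" using assms(1) by (simp add: lspan_def)
  then have "p \<in> lspan S \<and> P p"
  proof (induction rule: laurent.span_induct_alt)
    case base
    then show ?case using assms(2) by (simp add: lspan_iff)
  next
    case (step c x y)
    then show ?case
      using assms(3) by (auto intro!: lspan_add lspan_scale lspan_lmono)
  qed
  then show ?thesis ..
qed

section \<open>The involution \<open>lstar\<close>\<close>

lemma lcoeff_lstar [simp]: "lcoeff (lstar p) (i, j) = cnj (lcoeff p (- i, - j))"
  by (simp add: lstar.rep_eq)

lemma lstar_lstar [simp]: "lstar (lstar p) = p"
  by (rule poly_mapping_eqI) (simp add: split_paired_all)

lemma lstar_zero [simp]: "lstar 0 = 0"
  by (rule poly_mapping_eqI) (simp add: split_paired_all)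

lemma lstar_add: "lstar (p + q) = lstar p + lstar q"
  by (rule poly_mapping_eqI) (simp add: split_paired_all lookup_add)

lemma lstar_lscale: "lstar (lscale c p) = lscale (cnj c) (lstar p)"
  by (rule poly_mapping_eqI) (simp add: split_paired_all)

lemma lstar_lmono: "lstar (lmono (i, j)) = lmono (- i, - j)"
  by (rule poly_mapping_eqI) (auto simp: lcoeff_lmono split: if_splits)

lemma lmono_mult: "lmono a * lmono b = lmono (a + b)"
  by (simp add: lmono_def mult_single)

lemma lmono_zero: "lmono 0 = 1"
  by (simp add: lmono_def)

text \<open>Both sides are additive and conjugate homogeneous in each factor, so two inductions
  leave only products of monomials.\<close>

lemma lstar_mult: "lstar (p * q) = lstar p * lstar q"
proof -
  have mono: "lstar (lmono a * q) = lstar (lmono a) * lstar q" for a q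
  proof -
    have "q \<in> lspan UNIV" by (simp add: lspan_iff)
    then show ?thesis
    proof (induction rule: lspan_induct)
      case zero
      then show ?case by simp
    next
      case (add c b q)
      obtain i j k l where "a = (i, j)" "b = (k, l)" by (metis surj_pair)
      with add show ?case
        by (simp add: lstar_add lstar_lscale lstar_lmono lmono_mult distrib_left mult_lscale_right)
    qed
  qed
  have "p \<in> lspan UNIV" by (simp add: lspan_iff)
  then show ?thesis
    by (induction rule: lspan_induct)
      (simp_all add: mono lstar_add lstar_lscale distrib_right mult_lscale_left)
qed

lemma lstar_in_lspan:
  assumes "p \<in> lspan S" and "\<And>i j. (i, j) \<in> S \<Longrightarrow> (- i, - j) \<in> T"
  shows "lstar p \<in> lspan T"
  using assms(1) unfolding lspan_iff
proof safe
  fix i j assume "Poly_Mapping.keys p \<subseteq> S" "(i, j) \<in> Poly_Mapping.keys (lstar p)"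
  then have "(- i, - j) \<in> S" by (auto simp: in_keys_iff)
  then show "(i, j) \<in> T" using assms(2) by fastforce
qed

section \<open>Evaluation at a point\<close>

lemma leval_superset:
  assumes "finite A" and "Poly_Mapping.keys p \<subseteq> A"
  shows "leval p z w = (\<Sum>(i, j)\<in>A. lcoeff p (i, j) * z powi i * w powi j)"
  unfolding leval_def
  by (rule sum.mono_neutral_left) (use assms in \<open>auto simp: in_keys_iff\<close>)

lemma leval_zero [simp]: "leval 0 z w = 0"
  by (simp add: leval_def)

lemma leval_add: "leval (p + q) z w = leval p z w + leval q z w"
proof -
  let ?A = "Poly_Mapping.keys p \<union> Poly_Mapping.keys q"
  have "Poly_Mapping.keys (p + q) \<subseteq> ?A" by (rule keys_add)
  then show ?thesis
    by (simp add: leval_superset[of ?A] lookup_add sum.distrib[symmetric] case_prod_unfold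
        distrib_right)
qed

lemma leval_lscale: "leval (lscale c p) z w = c * leval p z w"
proof -
  have "Poly_Mapping.keys (lscale c p) \<subseteq> Poly_Mapping.keys p"
    by (auto simp: in_keys_iff)
  then show ?thesis
    by (simp add: leval_superset[of "Poly_Mapping.keys p"] sum_distrib_left case_prod_unfold
        mult.assoc)
qed

lemma leval_sum: "leval (sum f I) z w = (\<Sum>i\<in>I. leval (f i) z w)"
  by (induction I rule: infinite_finite_induct) (simp_all add: leval_add)

lemma leval_lmono: "leval (lmono (i, j)) z w = z powi i * w powi j"
  by (simp add: leval_def lmono_def)

text \<open>Nonnegative exponents make this valid at \<open>z = 0\<close> too: there
  \<open>z * z powi (-1)\<close> is 0 while \<open>z powi 0\<close> is 1.\<close>

lemma leval_shift:
  assumes "p \<in> lspan ({0..} \<times> {0..})"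
  shows "leval (lmono (1, 0) * p) z w = z * leval p z w"
  using assms
proof (induction rule: lspan_induct)
  case zero
  then show ?case by simp
next
  case (add c a q)
  obtain i j where a: "a = (i, j)" "0 \<le> i" using add by auto
  then have "z powi (1 + i) = z * z powi i"
    by (simp add: power_int_add)
  with add a show ?case
    by (simp add: distrib_left mult_lscale_right leval_add leval_lscale lmono_mult leval_lmono
        algebra_simps)
qed

section \<open>Reversals and shifts inside the bracket, for arbitrary \<open>L\<close>\<close>

lemma bracket_reversal:
  "bracket L (lmono a * lstar p) (lmono a * lstar q) = bracket L q p"
proof -
  \<comment> \<open>A monomial is inverse to its star, so the factors cancel before \<open>L\<close>
    is applied.\<close>
  have "lmono a * lstar (lmono a) = 1"
    by (cases a) (simp add: lstar_lmono lmono_mult zero_prod_def[symmetric] lmono_zero)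
  then have "lmono a * lstar p * lstar (lmono a * lstar q) = q * lstar p"
    by (simp add: lstar_mult mult.commute[of "lmono a"] mult.assoc)
  then show ?thesis by (simp add: bracket_def)
qed

lemma bracket_shift: "bracket L (lmono a * p) (lmono a * q) = bracket L p q"
  using bracket_reversal[of L a "lstar p" "lstar q"]
  by (simp add: bracket_def mult.commute)

text \<open>Once the common shift by \<open>a\<close> is cancelled, both sides are \<open>L\<close>
  of \<open>lmono b * lstar p * lstar q\<close>, which is symmetric in \<open>p\<close> and
  \<open>q\<close>. A reversal of \<open>p\<close> is thus traded for one of
  \<open>q\<close>.\<close>

lemma bracket_reversal_shift:
  "bracket L (lmono (a + b) * lstar p) (lmono a * q) = bracket L (lmono b * lstar q) p"
  using bracket_shift[of L a "lmono b * lstar p" q]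
  by (simp add: bracket_def lmono_mult[symmetric] mult_ac)

section \<open>Exponent rectangles and orthonormal bases\<close>

definition rect :: "nat \<Rightarrow> nat \<Rightarrow> (int \<times> int) set" where
  "rect n m = {0..int n} \<times> {0..int m}"

lemma finite_rect [simp]: "finite (rect n m)"
  by (simp add: rect_def)

lemma rect_mono: "n \<le> n' \<Longrightarrow> m \<le> m' \<Longrightarrow> rect n m \<subseteq> rect n' m'"
  by (auto simp: rect_def)

lemma card_rect: "card (rect n m) = Suc n * Suc m"
  by (simp add: rect_def nat_add_distrib)

lemma Pi_hat_eq: "Pi_hat n m = lspan (rect n m)"
  unfolding Pi_hat_def by (rule arg_cong[where f = lspan]) (auto simp: rect_def)

text \<open>Spanning is encoded by counting: for finite \<open>S\<close>, \<open>card S\<close> is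
  the dimension of \<open>lspan S\<close>.\<close>

definition orthonormal_basis ::
    "(laurent \<Rightarrow> complex) \<Rightarrow> (int \<times> int) set \<Rightarrow> 'i set \<Rightarrow> ('i \<Rightarrow> laurent) \<Rightarrow> bool" where
  "orthonormal_basis L S I e \<longleftrightarrow> finite I \<and> card I = card S \<and> e ` I \<subseteq> lspan S \<and>
     (\<forall>i\<in>I. \<forall>j\<in>I. bracket L (e i) (e j) = (if i = j then 1 else 0))"

section \<open>The inner product on the polynomials of the rectangle with corner
  \<open>(N, M)\<close>\<close>

locale pd_functional =
  fixes L :: "laurent \<Rightarrow> complex" and N M :: nat
  assumes pd: "positive_definite_functional N M L"
begin

abbreviation "V \<equiv> lspan (rect N M)"

lemma L_add: "p \<in> Pi_sp N M \<Longrightarrow> q \<in> Pi_sp N M \<Longrightarrow> L (p + q) = L p + L q"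
  using pd by (auto simp: positive_definite_functional_def hermitian_functional_def)

lemma L_scale: "p \<in> Pi_sp N M \<Longrightarrow> L (lscale c p) = c * L p"
  using pd by (auto simp: positive_definite_functional_def hermitian_functional_def)

lemma L_zero [simp]: "L 0 = 0"
  using L_scale[of 0 0] by (simp add: Pi_sp_def lspan_iff)

text \<open>Hermitian symmetry is given on monomials; conjugate linearity of \<open>lstar\<close>
  extends it.\<close>

lemma L_lstar:
  assumes "p \<in> Pi_sp N M"
  shows "L (lstar p) = cnj (L p)"
  using assms unfolding Pi_sp_def
proof (induction rule: lspan_induct)
  case zero
  then show ?case by simp
next
  case (add c a q)
  obtain i j where a: "a = (i, j)" "\<bar>i\<bar> \<le> int N" "\<bar>j\<bar> \<le> int M" using add by auto
  have mem: "lmono (i, j) \<in> Pi_sp N M" "lmono (- i, - j) \<in> Pi_sp N M"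
    using a by (simp_all add: Pi_sp_def lspan_lmono)
  have "q \<in> Pi_sp N M" "lstar q \<in> Pi_sp N M"
    using add(2) lstar_in_lspan[of q _ "{(i, j). \<bar>i\<bar> \<le> int N \<and> \<bar>j\<bar> \<le> int M}"]
    by (auto simp: Pi_sp_def)
  moreover have "L (lmono (- i, - j)) = cnj (L (lmono (i, j)))"
    using pd a by (auto simp: positive_definite_functional_def hermitian_functional_def)
  moreover have "lscale c (lmono (i, j)) \<in> Pi_sp N M"
    "lscale (cnj c) (lmono (- i, - j)) \<in> Pi_sp N M"
    using mem by (simp_all add: Pi_sp_def lspan_scale)
  ultimately show ?case
    using add(3) mem by (simp add: a(1) lstar_add lstar_lscale lstar_lmono L_add L_scale)
qed

text \<open>Differences of exponents from \<open>rect N M\<close> stay in the range where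
  \<open>L\<close> is linear. This is why the bracket laws are stated on \<open>V\<close>.\<close>

lemma mult_lstar_mem: "p \<in> V \<Longrightarrow> q \<in> V \<Longrightarrow> p * lstar q \<in> Pi_sp N M"
  unfolding Pi_sp_def
  by (rule lspan_mult[where S = "rect N M" and T = "{- int N..0} \<times> {- int M..0}"])
    (auto simp: rect_def intro: lstar_in_lspan)

lemma bracket_add_left:
  "p \<in> V \<Longrightarrow> q \<in> V \<Longrightarrow> r \<in> V \<Longrightarrow> bracket L (p + q) r = bracket L p r + bracket L q r"
  by (simp add: bracket_def distrib_right L_add mult_lstar_mem)

lemma bracket_scale_left:
  "p \<in> V \<Longrightarrow> r \<in> V \<Longrightarrow> bracket L (lscale c p) r = c * bracket L p r"
  by (simp add: bracket_def mult_lscale_left L_scale mult_lstar_mem)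

lemma bracket_cnj: "p \<in> V \<Longrightarrow> q \<in> V \<Longrightarrow> bracket L q p = cnj (bracket L p q)"
  using L_lstar[OF mult_lstar_mem[of p q]] by (simp add: bracket_def lstar_mult mult.commute)

lemma bracket_add_right:
  "p \<in> V \<Longrightarrow> q \<in> V \<Longrightarrow> r \<in> V \<Longrightarrow> bracket L r (p + q) = bracket L r p + bracket L r q"
  by (simp add: bracket_cnj[of _ r] bracket_add_left lspan_add)

lemma bracket_scale_right:
  "p \<in> V \<Longrightarrow> r \<in> V \<Longrightarrow> bracket L r (lscale c p) = cnj c * bracket L r p"
  by (simp add: bracket_cnj[of _ r] bracket_scale_left lspan_scale)

lemma bracket_zero [simp]: "bracket L 0 p = 0" "bracket L p 0 = 0"
  by (simp_all add: bracket_def)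

lemma bracket_diff_left:
  assumes "p \<in> V" "q \<in> V" "r \<in> V"
  shows "bracket L (p - q) r = bracket L p r - bracket L q r"
  using bracket_add_left[of "p - q" q r] assms by (simp add: lspan_diff)

lemma bracket_sum_left:
  "(\<And>i. i \<in> I \<Longrightarrow> f i \<in> V) \<Longrightarrow> r \<in> V \<Longrightarrow> bracket L (sum f I) r = (\<Sum>i\<in>I. bracket L (f i) r)"
  by (induction I rule: infinite_finite_induct) (simp_all add: bracket_add_left lspan_sum)

lemma bracket_pos: "p \<in> V \<Longrightarrow> p \<noteq> 0 \<Longrightarrow> 0 < bracket L p p"
  using pd by (simp add: positive_definite_functional_def Pi_hat_eq)

lemma bracket_eq_0_iff: "p \<in> V \<Longrightarrow> bracket L p p = 0 \<longleftrightarrow> p = 0"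
  using bracket_pos[of p] by (cases "p = 0") auto

section \<open>Projections and the orthonormal elements\<close>

lemma bracket_lspan_right:
  assumes "q \<in> lspan S" and "S \<subseteq> rect N M" and "p \<in> V"
    and "\<And>b. b \<in> S \<Longrightarrow> bracket L p (lmono b) = 0"
  shows "bracket L p q = 0"
  using assms(1)
proof (induction rule: lspan_induct)
  case zero
  then show ?case by simp
next
  case (add c a q)
  then show ?case
    using assms(2-4) lspan_mono[of _ S "rect N M"] lspan_lmono[of a S]
    by (simp add: bracket_add_right bracket_scale_right lspan_scale)
qed

text \<open>Gram-Schmidt, adding one exponent at a time; the vector \<open>x\<close> varies in the
  induction because the new monomial has to be projected as well.\<close>

lemma ex_projection:
  assumes "finite S" and "S \<subseteq> rect N M" and "x \<in> V"
  shows "\<exists>y\<in>lspan S. \<forall>b\<in>S. bracket L (x - y) (lmono b) = 0"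
  using assms
proof (induction S arbitrary: x rule: finite_induct)
  case empty
  have "0 \<in> lspan {}" by (simp add: lspan_iff)
  then show ?case by auto
next
  case (insert b S)
  have S: "S \<subseteq> rect N M" and bV: "lmono b \<in> V"
    using insert.prems by (auto intro: lspan_lmono)
  obtain y0 where y0: "y0 \<in> lspan S" "\<And>a. a \<in> S \<Longrightarrow> bracket L (x - y0) (lmono a) = 0"
    using insert.IH[OF S \<open>x \<in> V\<close>] by auto
  obtain yb where yb: "yb \<in> lspan S" "\<And>a. a \<in> S \<Longrightarrow> bracket L (lmono b - yb) (lmono a) = 0"
    using insert.IH[OF S bV] by auto
  \<comment> \<open>The part of the new monomial orthogonal to the old span. It is nonzero since
    \<open>yb\<close> has no term at \<open>b\<close>, so dividing by its squared norm is
    legitimate.\<close>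
  define c where "c = lmono b - yb"
  have V: "y0 \<in> V" "yb \<in> V" "c \<in> V"
    using y0 yb bV S by (auto simp: c_def intro: lspan_mono lspan_diff)
  have "lcoeff yb b = 0"
    using yb(1) insert.hyps(2) by (auto simp: lspan_iff in_keys_iff)
  then have "lcoeff c b = 1"
    by (simp add: c_def lookup_minus lcoeff_lmono)
  then have "c \<noteq> 0" by auto
  then have cc: "bracket L c c \<noteq> 0"
    using bracket_eq_0_iff V by simp
  have c_perp: "bracket L c q = 0" if "q \<in> lspan S" for q
    using bracket_lspan_right[OF that S] V yb by (simp add: c_def)
  \<comment> \<open>The Fourier coefficient of \<open>x\<close> along \<open>c\<close>; it is also
    that of \<open>x - y0\<close>, because \<open>y0\<close> is orthogonal to
    \<open>c\<close>.\<close>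
  define t where "t = bracket L x c / bracket L c c"
  define y where "y = y0 + lscale t c"
  have y_mem: "y \<in> lspan (insert b S)"
    unfolding y_def c_def using y0 yb
    by (intro lspan_add lspan_scale lspan_diff lspan_lmono) (auto elim: lspan_mono)
  have diff: "bracket L (x - y) q = bracket L (x - y0) q - t * bracket L c q" if "q \<in> V" for q
    using V \<open>x \<in> V\<close> that
    by (simp add: y_def diff_diff_eq[symmetric] bracket_diff_left bracket_scale_left lspan_diff
        lspan_scale)
  have perp_S: "bracket L (x - y) (lmono a) = 0" if "a \<in> S" for a
  proof -
    have "lmono a \<in> V" using that S by (auto intro: lspan_lmono)
    then show ?thesis using that diff y0 c_perp lspan_lmono by simp
  qed
  have "bracket L y0 c = 0"
    using c_perp[OF y0(1)] bracket_cnj[of c y0] V by simp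
  then have perp_c: "bracket L (x - y) c = 0"
    using V \<open>x \<in> V\<close> cc by (simp add: diff bracket_diff_left t_def)
  have xyV: "x - y \<in> V"
    using V \<open>x \<in> V\<close> by (simp add: y_def lspan_diff lspan_add lspan_scale)
  \<comment> \<open>Orthogonality to \<open>c\<close> and to \<open>yb\<close> yields orthogonality
    to their sum \<open>lmono b\<close>.\<close>
  have "bracket L (x - y) yb = 0"
    by (rule bracket_lspan_right[OF yb(1) S xyV perp_S])
  then have "bracket L (x - y) (lmono b) = 0"
    using perp_c bracket_add_right[of c yb "x - y"] V xyV by (simp add: c_def)
  then show ?case using perp_S y_mem by blast
qed

text \<open>The definite description is justified here: the normalised remainder of a projection
  gives existence, and positivity of the coefficient at \<open>a\<close> removes the freedom of a
  unimodular factor.\<close>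

lemma orthonormal_elt_properties:
  assumes S: "S \<subseteq> rect N M" and a: "a \<in> S"
  defines "p \<equiv> orthonormal_elt L S a"
  shows "p \<in> lspan S" "bracket L p p = 1" "\<And>q. q \<in> lspan (S - {a}) \<Longrightarrow> bracket L p q = 0"
proof -
  let ?P = "\<lambda>p. p \<in> lspan S \<and> 0 < lcoeff p a \<and> bracket L p p = 1 \<and>
    (\<forall>b\<in>S - {a}. bracket L p (lmono b) = 0)"
  have "finite S" using S finite_rect by (rule finite_subset)
  have S': "S - {a} \<subseteq> rect N M" using S by auto
  have aV: "lmono a \<in> V" using a S by (auto intro: lspan_lmono)
  have perp: "bracket L p q = 0"
    if "p \<in> V" "\<forall>b\<in>S - {a}. bracket L p (lmono b) = 0" "q \<in> lspan (S - {a})" for p q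
    using bracket_lspan_right[OF that(3) S' that(1)] that(2) by auto
  have ex: "\<exists>p. ?P p"
  proof -
    obtain y where y: "y \<in> lspan (S - {a})" "\<forall>b\<in>S - {a}. bracket L (lmono a - y) (lmono b) = 0"
      using ex_projection[OF _ S' aV] \<open>finite S\<close> by auto
    define c where "c = lmono a - y"
    have cS: "c \<in> lspan S"
      using y a by (auto simp: c_def intro: lspan_diff lspan_lmono lspan_mono)
    then have cV: "c \<in> V" using S lspan_mono by blast
    have "lcoeff y a = 0"
      using y(1) by (auto simp: lspan_iff in_keys_iff)
    then have ca: "lcoeff c a = 1"
      by (simp add: c_def lookup_minus lcoeff_lmono)
    then have "c \<noteq> 0" by auto
    then have pos: "0 < bracket L c c" using bracket_pos cV by simp
    define r where "r = Re (bracket L c c)"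
    have r: "r > 0" "bracket L c c = of_real r"
      using pos by (auto simp: r_def less_complex_def complex_eq_iff)
    \<comment> \<open>Scaling by \<open>s\<close> gives norm one, and the coefficient at
      \<open>a\<close>, previously 1, becomes \<open>s > 0\<close>.\<close>
    define s where "s = 1 / sqrt r"
    have s: "s > 0" "s * s * r = 1"
      using r by (simp_all add: s_def field_simps)
    have "bracket L (lscale (of_real s) c) (lscale (of_real s) c) = of_real (s * s * r)"
      using cV r by (simp add: bracket_scale_left bracket_scale_right lspan_scale mult.assoc)
    moreover have "0 < lcoeff (lscale (of_real s) c) a"
      using ca s by (simp add: less_complex_def)
    moreover have "bracket L (lscale (of_real s) c) (lmono b) = 0" if "b \<in> S - {a}" for b
    proof -
      have "lmono b \<in> V" using that S by (auto intro: lspan_lmono)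
      then show ?thesis using cV y(2) that by (simp add: bracket_scale_left c_def)
    qed
    ultimately have "?P (lscale (of_real s) c)"
      using cS s by (simp add: lspan_scale)
    then show ?thesis ..
  qed
  have unique: "p = q" if p: "?P p" and q: "?P q" for p q
  proof -
    have V: "p \<in> V" "q \<in> V" using p q S lspan_mono by blast+
    \<comment> \<open>Both coefficients at \<open>a\<close> are positive reals; their ratio is
      chosen so that the terms at \<open>a\<close> cancel in \<open>d\<close>.\<close>
    define t where "t = Re (lcoeff p a) / Re (lcoeff q a)"
    have t: "t > 0" "lcoeff p a = of_real t * lcoeff q a"
      using p q by (auto simp: t_def less_complex_def complex_eq_iff)
    define d where "d = p - lscale (of_real t) q"
    have dS: "d \<in> lspan (S - {a})"
    proof -
      have "d \<in> lspan S" using p q by (simp add: d_def lspan_diff lspan_scale)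
      moreover have "lcoeff d a = 0" using t by (simp add: d_def lookup_minus)
      ultimately show ?thesis by (auto simp: lspan_iff in_keys_iff)
    qed
    then have dV: "d \<in> V" using S' lspan_mono by blast
    \<comment> \<open>Having no term at \<open>a\<close>, \<open>d\<close> is orthogonal to
      \<open>p\<close> and \<open>q\<close>, hence to itself.\<close>
    have "bracket L p d = 0" "bracket L q d = 0"
      using perp V p q dS by blast+
    then have "bracket L d d = 0"
      using V dV by (simp add: d_def[symmetric] bracket_diff_left bracket_scale_left lspan_scale
          bracket_diff_left[of p "lscale (of_real t) q" d, folded d_def])
    then have "d = 0" using dV bracket_eq_0_iff by simp
    then have pq: "p = lscale (of_real t) q" by (simp add: d_def)
    then have "bracket L p p = of_real (t * t) * bracket L q q"
      using V by (simp add: bracket_scale_left bracket_scale_right lspan_scale)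
    then have "of_real (t * t) = (1::complex)" using p q by simp
    then have "t * t = 1" using of_real_eq_1_iff by blast
    then have "t = 1" using t(1) by (simp add: square_eq_1_iff)
    then show ?thesis using pq by simp
  qed
  have P: "?P p"
    unfolding p_def orthonormal_elt_def
    by (rule theI') (use ex unique in blast)
  then show "p \<in> lspan S" "bracket L p p = 1" by auto
  show "bracket L p q = 0" if "q \<in> lspan (S - {a})" for q
    using perp[of p q] P that S lspan_mono by blast
qed

section \<open>Orthonormal bases and their kernels\<close>

lemma nested_orthonormal_basis:
  assumes S: "S \<subseteq> rect N M" and bij: "bij_betw a I S"
    and T: "\<And>i. i \<in> I \<Longrightarrow> a i \<in> T i" "\<And>i. i \<in> I \<Longrightarrow> T i \<subseteq> S"
    and nested: "\<And>i j. i \<in> I \<Longrightarrow> j \<in> I \<Longrightarrow> i \<noteq> j \<Longrightarrow> T i \<subseteq> T j - {a j} \<or> T j \<subseteq> T i - {a i}"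
  shows "orthonormal_basis L S I (\<lambda>i. orthonormal_elt L (T i) (a i))" (is "orthonormal_basis _ _ _ ?e")
  unfolding orthonormal_basis_def
proof (intro conjI ballI)
  have TN: "T i \<subseteq> rect N M" if "i \<in> I" for i using T(2) S that by blast
  note elt = orthonormal_elt_properties[OF TN T(1)]
  have "finite S" using S finite_rect by (rule finite_subset)
  then show "finite I" "card I = card S"
    using bij bij_betw_finite bij_betw_same_card by blast+
  show "?e ` I \<subseteq> lspan S"
    using elt(1) T(2) lspan_mono by blast
  have V: "?e i \<in> V" if "i \<in> I" for i
    using elt(1) that TN lspan_mono by blast
  \<comment> \<open>The smaller set omits the leading exponent of the larger one, so its element
    lies in the span to which the other element is orthogonal.\<close>
  have zero: "bracket L (?e i) (?e j) = 0" if "i \<in> I" "j \<in> I" "T j \<subseteq> T i - {a i}" for i j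
    using elt(1)[of j] elt(3)[of i "?e j"] that lspan_mono by blast
  fix i j assume ij: "i \<in> I" "j \<in> I"
  show "bracket L (?e i) (?e j) = (if i = j then 1 else 0)"
  proof (cases "i = j")
    case True
    then show ?thesis using elt(2) ij by simp
  next
    case False
    then show ?thesis
      using nested[OF ij False] zero[of i j] zero[of j i] bracket_cnj[of "?e j" "?e i"] V ij by auto
  qed
qed

text \<open>A nonzero remainder \<open>d\<close> would be orthogonal to the whole family; together
  they would be \<open>card S + 1\<close> independent elements in a span of \<open>card S\<close>
  monomials.\<close>

lemma orthonormal_basis_expansion:
  assumes onb: "orthonormal_basis L S I e" and S: "S \<subseteq> rect N M" and x: "x \<in> lspan S"
  shows "x = (\<Sum>i\<in>I. lscale (bracket L x (e i)) (e i))"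
proof (rule ccontr)
  assume "\<not> ?thesis"
  define d where "d = x - (\<Sum>i\<in>I. lscale (bracket L x (e i)) (e i))"
  from \<open>\<not> ?thesis\<close> have "d \<noteq> 0" by (simp add: d_def)
  have I: "finite I" "card I = card S" and eS: "\<And>i. i \<in> I \<Longrightarrow> e i \<in> lspan S"
    and orth: "\<And>i j. i \<in> I \<Longrightarrow> j \<in> I \<Longrightarrow> bracket L (e i) (e j) = (if i = j then 1 else 0)"
    using onb by (auto simp: orthonormal_basis_def)
  have "finite S" using S finite_rect by (rule finite_subset)
  have inV: "q \<in> V" if "q \<in> lspan S" for q using that S lspan_mono by blast
  have dS: "d \<in> lspan S"
    using x eS unfolding d_def by (intro lspan_diff lspan_sum lspan_scale) auto
  have de: "bracket L d (e j) = 0" if "j \<in> I" for j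
  proof -
    have "bracket L (\<Sum>i\<in>I. lscale (bracket L x (e i)) (e i)) (e j)
        = (\<Sum>i\<in>I. bracket L x (e i) * (if i = j then 1 else 0))"
      using eS inV that orth
      by (subst bracket_sum_left) (auto simp: bracket_scale_left lspan_scale intro!: sum.cong)
    also have "\<dots> = bracket L x (e j)"
      using I that by (simp add: if_distrib[of "(*) _"] cong: if_cong)
    finally show ?thesis
      using x eS inV that by (simp add: d_def bracket_diff_left lspan_sum lspan_scale)
  qed
  have ed: "bracket L (e j) d = 0" if "j \<in> I" for j
    using de[OF that] bracket_cnj[of d "e j"] inV dS eS that by simp
  let ?B = "insert d (e ` I)"
  have B_S: "?B \<subseteq> lspan S" using dS eS by auto
  have B_perp: "bracket L u v = 0" if "u \<in> ?B" "v \<in> ?B" "u \<noteq> v" for u v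
    using that de ed orth by auto
  have B_norm: "bracket L v v \<noteq> 0" if "v \<in> ?B" for v
    using that bracket_eq_0_iff inV dS \<open>d \<noteq> 0\<close> orth by auto
  have "laurent.independent ?B"
  proof (rule laurent.independent_if_scalars_zero)
    show "finite ?B" using I by simp
    fix f v assume sum: "(\<Sum>u\<in>?B. lscale (f u) u) = 0" and v: "v \<in> ?B"
    have "0 = bracket L (\<Sum>u\<in>?B. lscale (f u) u) v" by (simp only: sum bracket_zero)
    also have "\<dots> = (\<Sum>u\<in>?B. f u * bracket L u v)"
      using B_S inV v
      by (subst bracket_sum_left) (auto simp: bracket_scale_left lspan_scale subset_eq intro!: sum.cong)
    also have "\<dots> = (\<Sum>u\<in>?B. if u = v then f v * bracket L v v else 0)"
      using B_perp v by (intro sum.cong) auto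
    also have "\<dots> = f v * bracket L v v" using I v by (subst sum.delta) auto
    finally show "f v = 0" using B_norm v by simp
  qed
  then have "card ?B \<le> card (lmono ` S)"
    using laurent.independent_span_bound[of "lmono ` S" ?B] B_S \<open>finite S\<close>
    by (simp add: lspan_def)
  also have "\<dots> \<le> card I" using I \<open>finite S\<close> by (simp add: card_image_le)
  also have "card I = card (e ` I)"
  proof (rule card_image[symmetric], rule inj_onI)
    fix i j assume "i \<in> I" "j \<in> I" "e i = e j"
    then show "i = j" using orth[of i j] orth[of j j] by (auto split: if_splits)
  qed
  also have "\<dots> < card ?B"
  proof -
    have "d \<notin> e ` I" using de B_norm[of d] by auto
    then show ?thesis using I by simp
  qed
  finally show False by simp
qed

text \<open>Expand \<open>e\<close> in \<open>f\<close> at the first point and \<open>f\<close> in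
  \<open>e\<close> at the second. By conjugate symmetry both expansions use the matrix
  \<open>bracket L (e i) (f j)\<close>, so the two sums are one double sum in different
  orders.\<close>

lemma kernel_unique:
  assumes e: "orthonormal_basis L S I e" and f: "orthonormal_basis L S J f"
    and S: "S \<subseteq> rect N M"
  shows "(\<Sum>i\<in>I. leval (e i) z w * cnj (leval (e i) z\<^sub>1 w\<^sub>1))
    = (\<Sum>j\<in>J. leval (f j) z w * cnj (leval (f j) z\<^sub>1 w\<^sub>1))"
proof -
  have mem: "\<And>i. i \<in> I \<Longrightarrow> e i \<in> lspan S" "\<And>j. j \<in> J \<Longrightarrow> f j \<in> lspan S"
    using e f by (auto simp: orthonormal_basis_def)
  have inV: "q \<in> V" if "q \<in> lspan S" for q using that S lspan_mono by blast
  have ei: "leval (e i) z w = (\<Sum>j\<in>J. bracket L (e i) (f j) * leval (f j) z w)" if "i \<in> I" for i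
    using arg_cong[OF orthonormal_basis_expansion[OF f S mem(1)[OF that]],
        of "\<lambda>p. leval p z w"]
    by (simp only: leval_sum leval_lscale)
  have fj: "cnj (leval (f j) z\<^sub>1 w\<^sub>1) = (\<Sum>i\<in>I. bracket L (e i) (f j) * cnj (leval (e i) z\<^sub>1 w\<^sub>1))"
    if "j \<in> J" for j
  proof -
    have "bracket L (e i) (f j) = cnj (bracket L (f j) (e i))" if "i \<in> I" for i
      using bracket_cnj[of "f j" "e i"] mem inV that \<open>j \<in> J\<close> by simp
    moreover have "leval (f j) z\<^sub>1 w\<^sub>1 = (\<Sum>i\<in>I. bracket L (f j) (e i) * leval (e i) z\<^sub>1 w\<^sub>1)"
      using arg_cong[OF orthonormal_basis_expansion[OF e S mem(2)[OF that]],
          of "\<lambda>p. leval p z\<^sub>1 w\<^sub>1"]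
      by (simp only: leval_sum leval_lscale)
    ultimately show ?thesis by (simp add: cnj_sum)
  qed
  have "(\<Sum>i\<in>I. leval (e i) z w * cnj (leval (e i) z\<^sub>1 w\<^sub>1))
      = (\<Sum>i\<in>I. \<Sum>j\<in>J. bracket L (e i) (f j) * leval (f j) z w * cnj (leval (e i) z\<^sub>1 w\<^sub>1))"
    by (intro sum.cong refl) (simp add: ei sum_distrib_right)
  also have "\<dots> = (\<Sum>j\<in>J. \<Sum>i\<in>I. bracket L (e i) (f j) * leval (f j) z w * cnj (leval (e i) z\<^sub>1 w\<^sub>1))"
    by (rule sum.swap)
  also have "\<dots> = (\<Sum>j\<in>J. leval (f j) z w * cnj (leval (f j) z\<^sub>1 w\<^sub>1))"
    by (intro sum.cong refl) (simp add: fj sum_distrib_left mult_ac)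
  finally show ?thesis .
qed

section \<open>Three orthonormal bases of one rectangle\<close>

lemma bij_betw_rect: "bij_betw (\<lambda>(i, j). (int i, int j)) ({..n} \<times> {..m}) (rect n m)"
  by (rule bij_betw_byWitness[where f' = "\<lambda>(i, j). (nat i, nat j)"]) (auto simp: rect_def)

lemma phi_basis:
  assumes "n \<le> N" and "m \<le> M"
  shows "orthonormal_basis L (rect n m) ({..n} \<times> {..m}) (\<lambda>(k, l). phi L k m l)"
proof -
  \<comment> \<open>The exponents up to \<open>(k, l)\<close> in the lexicographic order that
    compares powers of \<open>z\<close> first; initial segments of a total order are nested.\<close>
  let ?T = "\<lambda>(k, l). {(i, j). 0 \<le> i \<and> i < int k \<and> 0 \<le> j \<and> j \<le> int m} \<union>
    {(i, j). i = int k \<and> 0 \<le> j \<and> j \<le> int l}"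
  have "orthonormal_basis L (rect n m) ({..n} \<times> {..m})
      (\<lambda>i. orthonormal_elt L (?T i) ((\<lambda>(i, j). (int i, int j)) i))"
  proof (rule nested_orthonormal_basis[OF rect_mono[OF assms] bij_betw_rect])
    fix p q :: "nat \<times> nat" assume "p \<in> {..n} \<times> {..m}" "q \<in> {..n} \<times> {..m}" "p \<noteq> q"
    moreover obtain k l k' l' where "p = (k, l)" "q = (k', l')"
      by (cases p; cases q) auto
    moreover have "?T (k, l) \<subseteq> ?T (k', l') - {(int k', int l')}"
      if "k < k' \<or> k = k' \<and> l < l'" "l \<le> m" for k l k' l'
      using that by auto
    ultimately show "?T p \<subseteq> ?T q - {(\<lambda>(i, j). (int i, int j)) q} \<or>
        ?T q \<subseteq> ?T p - {(\<lambda>(i, j). (int i, int j)) p}"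
      by (metis (mono_tags, lifting) atMost_iff case_prod_conv linorder_neqE_nat mem_Sigma_iff)
  qed (auto simp: rect_def)
  then show ?thesis by (simp add: phi_def case_prod_unfold)
qed

text \<open>The same argument with powers of \<open>w\<close> compared first. The arguments are
  swapped in \<open>phi_tilde L n l k\<close> so that the index \<open>(k, l)\<close> is again the
  leading exponent.\<close>

lemma phi_tilde_basis:
  assumes "n \<le> N" and "m \<le> M"
  shows "orthonormal_basis L (rect n m) ({..n} \<times> {..m}) (\<lambda>(k, l). phi_tilde L n l k)"
proof -
  let ?T = "\<lambda>(k, l). {(i, j). 0 \<le> i \<and> i \<le> int n \<and> 0 \<le> j \<and> j < int l} \<union>
    {(i, j). 0 \<le> i \<and> i \<le> int k \<and> j = int l}"
  have "orthonormal_basis L (rect n m) ({..n} \<times> {..m})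
      (\<lambda>i. orthonormal_elt L (?T i) ((\<lambda>(i, j). (int i, int j)) i))"
  proof (rule nested_orthonormal_basis[OF rect_mono[OF assms] bij_betw_rect])
    fix p q :: "nat \<times> nat" assume "p \<in> {..n} \<times> {..m}" "q \<in> {..n} \<times> {..m}" "p \<noteq> q"
    moreover obtain k l k' l' where "p = (k, l)" "q = (k', l')"
      by (cases p; cases q) auto
    moreover have "?T (k, l) \<subseteq> ?T (k', l') - {(int k', int l')}"
      if "l < l' \<or> l = l' \<and> k < k'" "k \<le> n" for k l k' l'
      using that by auto
    ultimately show "?T p \<subseteq> ?T q - {(\<lambda>(i, j). (int i, int j)) q} \<or>
        ?T q \<subseteq> ?T p - {(\<lambda>(i, j). (int i, int j)) p}"
      by (metis (mono_tags, lifting) atMost_iff case_prod_conv linorder_neqE_nat mem_Sigma_iff)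
  qed (auto simp: rect_def)
  then show ?thesis by (simp add: phi_tilde_def case_prod_unfold)
qed

lemma phi_in_lspan:
  assumes "n \<le> N" and "m \<le> M" and "l \<le> m"
  shows "phi L n m l \<in> lspan (rect n m)"
  using phi_basis[OF assms(1,2)] assms(3) by (auto simp: orthonormal_basis_def)

text \<open>All columns left of column \<open>n\<close> precede \<open>(n, l)\<close> in the order,
  up to full height \<open>m\<close>; for \<open>n = 0\<close> there are none.\<close>

lemma phi_orthogonal:
  assumes "n \<le> N" and "m \<le> M" and "l \<le> m" and "q \<in> lspan ({0..int n - 1} \<times> {0..int m})"
  shows "bracket L (phi L n m l) q = 0"
  unfolding phi_def
proof (rule orthonormal_elt_properties(3))
  show "q \<in> lspan ({(i, j). 0 \<le> i \<and> i < int n \<and> 0 \<le> j \<and> j \<le> int m} \<union>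
      {(i, j). i = int n \<and> 0 \<le> j \<and> j \<le> int l} - {(int n, int l)})"
    by (rule lspan_mono[OF assms(4)]) auto
qed (use assms(1-3) in \<open>auto simp: rect_def\<close>)

text \<open>Reversal and shift preserve orthonormality within each group, so only the mixed brackets
  need the orthogonality of \<open>phi L n m l\<close> to lower columns.\<close>

lemma reversed_basis:
  assumes n: "n \<le> N" and m: "m \<le> M"
  shows "orthonormal_basis L (rect n m) ({..n} \<times> {..m})
    (\<lambda>(k, l). if k = n then lmono (int n, int m) * lstar (phi L n m l)
      else lmono (1, 0) * phi L k m l)" (is "orthonormal_basis _ _ ?I ?e")
  unfolding orthonormal_basis_def
proof (intro conjI ballI)
  show "finite ?I" by simp
  show "card ?I = card (rect n m)" by (simp add: card_rect)
  have orth: "bracket L (phi L k m l) (phi L k' m l') = (if k = k' \<and> l = l' then 1 else 0)"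
    if "k \<le> n" "k' \<le> n" "l \<le> m" "l' \<le> m" for k k' l l'
    using phi_basis[OF n m] that by (auto simp: orthonormal_basis_def)
  have rev_mem: "lmono (int n, int m) * lstar (phi L n m l) \<in> lspan (rect n m)" if "l \<le> m" for l
  proof (rule lspan_mult)
    show "lstar (phi L n m l) \<in> lspan ({- int n..0} \<times> {- int m..0})"
      using phi_in_lspan[OF n m that] by (rule lstar_in_lspan) (auto simp: rect_def)
    show "lmono (int n, int m) \<in> lspan {(int n, int m)}" by (simp add: lspan_lmono)
  qed (auto simp: rect_def)
  have phi_mem: "phi L k m l \<in> lspan ({0..int n - 1} \<times> {0..int m})" if "k < n" "l \<le> m" for k l
    by (rule lspan_mono[OF phi_in_lspan]) (use that n m in \<open>auto simp: rect_def\<close>)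
  have shift_mem: "lmono (1, 0) * phi L k m l \<in> lspan (rect n m)" if "k < n" "l \<le> m" for k l
    using lspan_lmono[of "(1, 0)" "{(1, 0)}"] phi_mem[OF that]
    by (rule lspan_mult) (auto simp: rect_def)
  show mem: "?e ` ?I \<subseteq> lspan (rect n m)"
    using rev_mem shift_mem by auto
  have inV: "q \<in> V" if "q \<in> lspan (rect n m)" for q
    using that rect_mono[OF n m] lspan_mono by blast
  have mixed: "bracket L (lmono (int n, int m) * lstar (phi L n m l)) (lmono (1, 0) * phi L k m l') = 0"
    if "k < n" "l \<le> m" "l' \<le> m" for k l l'
  proof -
    let ?R = "{0..int n - 1} \<times> {0..int m}"
    \<comment> \<open>Cancelling the shift by \<open>z\<close> leaves the reversal of
      \<open>phi L k m l'\<close> in the rectangle with corner \<open>(n - 1, m)\<close>. As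
      \<open>k < n\<close>, it is a polynomial of \<open>z\<close>-degree below \<open>n\<close>, to
      which \<open>phi L n m l\<close> is orthogonal.\<close>
    let ?q = "lmono (int n - 1, int m) * lstar (phi L k m l')"
    have "lstar (phi L k m l') \<in> lspan ({1 - int n..0} \<times> {- int m..0})"
      using phi_mem[OF that(1,3)] by (rule lstar_in_lspan) auto
    with lspan_lmono[of "(int n - 1, int m)" "{(int n - 1, int m)}"]
    have q: "?q \<in> lspan ?R" by (rule lspan_mult) auto
    have "?R \<subseteq> rect n m" by (auto simp: rect_def)
    then have "?q \<in> V" using q lspan_mono inV by blast
    moreover have "phi L n m l \<in> V" using phi_in_lspan[OF n m that(2)] inV by blast
    ultimately have "bracket L ?q (phi L n m l) = 0"
      using bracket_cnj[of "phi L n m l" ?q] phi_orthogonal[OF n m that(2) q] by simp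
    then show ?thesis
      using bracket_reversal_shift[of L "(1, 0)" "(int n - 1, int m)" "phi L n m l" "phi L k m l'"] by simp
  qed
  fix p q assume "p \<in> ?I" "q \<in> ?I"
  moreover obtain k l k' l' where pq: "p = (k, l)" "q = (k', l')" by (metis surj_pair)
  ultimately have le: "k \<le> n" "k' \<le> n" "l \<le> m" "l' \<le> m" by auto
  have "bracket L (lmono (1, 0) * phi L k m l) (lmono (int n, int m) * lstar (phi L n m l')) = 0" if "k < n"
    using mixed[OF that le(4,3)]
      bracket_cnj[OF inV[OF rev_mem[OF le(4)]] inV[OF shift_mem[OF that le(3)]]]
    by simp
  then show "bracket L (?e p) (?e q) = (if p = q then 1 else 0)"
    using le mixed[of k' l l'] orth
    by (auto simp: pq bracket_reversal bracket_shift[of L "(1, 0)"])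
qed

end

section \<open>Assembling the formula\<close>

lemma veval_scalar_prod:
  "veval (vec (m + 1) (\<lambda>k. f (m - k))) z w \<bullet>c veval (vec (m + 1) (\<lambda>k. f (m - k))) z\<^sub>1 w\<^sub>1
    = (\<Sum>l\<le>m. leval (f l) z w * cnj (leval (f l) z\<^sub>1 w\<^sub>1))"
proof -
  let ?g = "\<lambda>l. leval (f l) z w * cnj (leval (f l) z\<^sub>1 w\<^sub>1)"
  have "veval (vec (m + 1) (\<lambda>k. f (m - k))) z w \<bullet>c veval (vec (m + 1) (\<lambda>k. f (m - k))) z\<^sub>1 w\<^sub>1
      = (\<Sum>k<Suc m. ?g (Suc m - Suc k))"
    by (simp add: scalar_prod_def veval_def atLeast0LessThan)
  also have "\<dots> = sum ?g {..<Suc m}" by (rule sum.nat_diff_reindex)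
  finally show ?thesis by (simp add: lessThan_Suc_atMost)
qed

theorem theorem4p2:
  fixes L :: "laurent \<Rightarrow> complex" and N M n m :: nat and z w z\<^sub>1 w\<^sub>1 :: complex
  assumes "positive_definite_functional N M L"
    and "n \<le> N" and "m \<le> M" and "cnj z\<^sub>1 * z \<noteq> 1"
  shows "(veval (Phi_rev L n m) z w \<bullet>c veval (Phi_rev L n m) z\<^sub>1 w\<^sub>1
          - cnj z\<^sub>1 * z * (veval (Phi L n m) z w \<bullet>c veval (Phi L n m) z\<^sub>1 w\<^sub>1)) / (1 - cnj z\<^sub>1 * z)
         = (\<Sum>k=0..n. veval (Phi L k m) z w \<bullet>c veval (Phi L k m) z\<^sub>1 w\<^sub>1)
       \<and> (\<Sum>k=0..n. veval (Phi L k m) z w \<bullet>c veval (Phi L k m) z\<^sub>1 w\<^sub>1)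
         = (\<Sum>j=0..m. veval (Phi_tilde L n j) z w \<bullet>c veval (Phi_tilde L n j) z\<^sub>1 w\<^sub>1)"
proof -
  interpret pd_functional L N M by unfold_locales fact
  note n = \<open>n \<le> N\<close> and m = \<open>m \<le> M\<close>
  let ?g = "\<lambda>p. leval p z w * cnj (leval p z\<^sub>1 w\<^sub>1)"
  have Phi: "veval (Phi L k m) z w \<bullet>c veval (Phi L k m) z\<^sub>1 w\<^sub>1 = (\<Sum>l\<le>m. ?g (phi L k m l))" for k
    unfolding Phi_def by (rule veval_scalar_prod)
  have Phi_tilde: "veval (Phi_tilde L n j) z w \<bullet>c veval (Phi_tilde L n j) z\<^sub>1 w\<^sub>1
      = (\<Sum>k\<le>n. ?g (phi_tilde L n j k))" for j
    unfolding Phi_tilde_def by (rule veval_scalar_prod)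
  let ?rev = "\<lambda>l. lmono (int n, int m) * lstar (phi L n m l)"
  have "Phi_rev L n m = vec (m + 1) (\<lambda>k. ?rev (m - k))"
    by (auto simp: Phi_rev_def Phi_def)
  then have Phi_rev: "veval (Phi_rev L n m) z w \<bullet>c veval (Phi_rev L n m) z\<^sub>1 w\<^sub>1
      = (\<Sum>l\<le>m. ?g (?rev l))"
    by (simp only:) (rule veval_scalar_prod)
  define K where "K = (\<Sum>k\<le>n. \<Sum>l\<le>m. ?g (phi L k m l))"
  define K' where "K' = (\<Sum>k<n. \<Sum>l\<le>m. ?g (phi L k m l))"
  have Phi_K: "(\<Sum>l\<le>m. ?g (phi L n m l)) = K - K'"
    by (simp add: K_def K'_def lessThan_Suc_atMost[symmetric])
  have K: "K = (\<Sum>(k, l)\<in>{..n} \<times> {..m}. ?g (phi L k m l))"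
    by (simp add: K_def sum.cartesian_product)
  also have "\<dots> = (\<Sum>(k, j)\<in>{..n} \<times> {..m}. ?g (phi_tilde L n j k))"
    using kernel_unique[OF phi_basis[OF n m] phi_tilde_basis[OF n m] rect_mono[OF n m], of z w z\<^sub>1 w\<^sub>1]
    by (simp add: case_prod_unfold)
  also have "\<dots> = (\<Sum>k\<le>n. \<Sum>j\<le>m. ?g (phi_tilde L n j k))"
    by (simp add: sum.cartesian_product)
  also have "\<dots> = (\<Sum>j\<le>m. \<Sum>k\<le>n. ?g (phi_tilde L n j k))"
    by (rule sum.swap)
  finally have tilde: "K = (\<Sum>j\<le>m. \<Sum>k\<le>n. ?g (phi_tilde L n j k))" .
  let ?e = "\<lambda>k l. if k = n then ?rev l else lmono (1, 0) * phi L k m l"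
  have shift: "?g (lmono (1, 0) * phi L k m l) = cnj z\<^sub>1 * z * ?g (phi L k m l)"
    if "k < n" "l \<le> m" for k l
  proof -
    have "phi L k m l \<in> lspan ({0..} \<times> {0..})"
      by (rule lspan_mono[OF phi_in_lspan]) (use that n m in \<open>auto simp: rect_def\<close>)
    then show ?thesis by (simp add: leval_shift)
  qed
  have "K = (\<Sum>(k, l)\<in>{..n} \<times> {..m}. ?g (?e k l))"
    unfolding K
    using kernel_unique[OF phi_basis[OF n m] reversed_basis[OF n m] rect_mono[OF n m], of z w z\<^sub>1 w\<^sub>1]
    by (simp add: case_prod_unfold)
  also have "\<dots> = (\<Sum>k<n. \<Sum>l\<le>m. ?g (?e k l)) + (\<Sum>l\<le>m. ?g (?rev l))"
    by (simp add: sum.cartesian_product[symmetric] lessThan_Suc_atMost[symmetric] del: sum.lessThan_Suc)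
      (simp add: sum.lessThan_Suc)
  also have "(\<Sum>k<n. \<Sum>l\<le>m. ?g (?e k l)) = cnj z\<^sub>1 * z * K'"
    unfolding K'_def sum_distrib_left by (intro sum.cong refl) (simp add: shift)
  finally have rev_K: "(\<Sum>l\<le>m. ?g (?rev l)) = K - cnj z\<^sub>1 * z * K'"
    by simp
  have "(\<Sum>l\<le>m. ?g (?rev l)) - cnj z\<^sub>1 * z * (\<Sum>l\<le>m. ?g (phi L n m l))
      = (1 - cnj z\<^sub>1 * z) * K"
    unfolding rev_K Phi_K by (simp add: algebra_simps)
  then have "((\<Sum>l\<le>m. ?g (?rev l)) - cnj z\<^sub>1 * z * (\<Sum>l\<le>m. ?g (phi L n m l))) / (1 - cnj z\<^sub>1 * z) = K"
    using assms(4) by simp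
  then show ?thesis
    using tilde unfolding Phi Phi_tilde Phi_rev atLeast0AtMost K_def[symmetric] by simp
qed

end
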